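(* Let $n$ be a positive integer. The map $\psi:B_n^{(1,2)}\to \mathrm{SW}(1^n)$ is a $q,u,v$-weight preserving bijection; that is, $\psi$ is a bijection and for every $b\in B_n^{(1,2)}$, with $\sigma=\psi(b)$: $\deg_x(b)=\mathrm{sminv}(\sigma)$, $\deg_\theta(b)$ is the number of ascents of $\sigma$, and $\deg_\xi(b)$ is the number of descents of $\sigma$.
   Context: **The set $B_n^{(1,2)}$.** A modified Motzkin path of length $n$ is a lattice path $\pi=(p_1,\ldots,p_n)$ in $\mathbb{Z}^2$ starting at $(0,0)$ whose $i$-th step $p_i$ is one of: an (undecorated) up-step $(1,1)$; a horizontal step $(1,0)$ with decoration $\theta_i$; a horizontal step $(1,0)$ with decoration $\xi_i$; a down-step $(1,-1)$ with decoration $\theta_i\xi_i$; such that the first step is an up-step and afterwards the path never goes below the line $y=1$. The set of these paths is $\Pi(n)_{>0}$. For $\pi\in\Pi(n)_{>0}$ let $T(\pi)$ (resp. $S(\pi)$) be the set of indices $i$ such that $\theta_i$ (resp. $\xi_i$) occurs in the decoration of $p_i$; both are subsets of $\{2,\ldots,n\}$. For $T,S\subseteq\{2,\ldots,n\}$ define $\alpha(T,S)$ by $\alpha_1(T,S)=0$ and, for $2\le i\le n$, $\alpha_i(T,S)=\alpha_{i-1}(T,S)-1+\chi(i\notin T)+\chi(i\notin S)$, where $\chi(P)=1$ if $P$ is true and $0$ otherwise. $B_n^{(1,2)}$ is the set of monomials $x^\alpha\theta_T\xi_S$ (with $x_i$ commuting, $\theta_i,\xi_i$ anticommuting variables, $\theta_T,\xi_S$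 the products in increasing order of indices) such that $(T,S)=(T(\pi),S(\pi))$ for some $\pi\in\Pi(n)_{>0}$ and $0\le\alpha_i\le\alpha_i(T,S)$ for all $i$. Signs are irrelevant: we write $b=\pm\prod_{i=1}^n x_i^{\alpha_i}\theta_i^{\beta_i}\xi_i^{\gamma_i}$ with $\alpha_i\in\mathbb{Z}_{\ge0}$, $\beta_i,\gamma_i\in\{0,1\}$, and $\deg_x(b)=\sum\alpha_i$, $\deg_\theta(b)=\sum\beta_i$, $\deg_\xi(b)=\sum\gamma_i$. **Segmented permutations.** $\mathrm{SW}(1^n)$ is the set of segmented permutations of length $n$: permutations $\sigma_1\cdots\sigma_n$ of $\{1,\ldots,n\}$ cut into consecutive nonempty blocks, with a bar "$|$" written between consecutive blocks. An ascent (resp. descent) of $\sigma$ is an index $i$ such that $\sigma_i,\sigma_{i+1}$ lie in the same block and $\sigma_i<\sigma_{i+1}$ (resp. $\sigma_i>\sigma_{i+1}$). A sminversion of $\sigma$ is a pair $(i,j)$ with $1\le i<j\le n$, $\sigma_i>\sigma_j$, and either $\sigma_j$ is the first letter of its block or $\sigma_{j-1}>\sigma_i$. $\mathrm{sminv}(\sigma)$ is the number of sminversions. **The map $\psi$.** Given $b=\pm\prod_{i} x_i^{\alpha_i}\theta_i^{\beta_i}\xi_i^{\gamma_i}\in B_n^{(1,2)}$ (necessarily $\alpha_1=\beta_1=\gamma_1=0$), start with the segmented permutation $1$. For $i=2,\ldots,n$ in turn: (a) if $\beta_i=\gamma_i=0$, insert a new block consisting only of $i$, so that it is the $(\alpha_i+1)$-st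 block from the right in the resulting word; (b) if $\beta_i=1,\gamma_i=0$, insert $i$ as the last element of the existing block which is $(\alpha_i+1)$-st from the right; (c) if $\beta_i=0,\gamma_i=1$, insert $i$ as the first element of the existing block which is $(\alpha_i+1)$-st from the right; (d) if $\beta_i=\gamma_i=1$, replace a bar "$|$" by $i$, merging two adjacent blocks into one block, so that this merged block is the $(\alpha_i+1)$-st from the right in the resulting word. The final segmented permutation is $\psi(b)$. *)

theory Defs
  imports "HOL-Combinatorics.Multiset_Permutations" "HOL-Library.Product_Plus"
begin

section \<open>Modified Motzkin paths\<close>

text \<open>
  The step \<open>p\<^sub>i\<close> can only carry the variables \<open>\<theta>\<^sub>i\<close>, \<open>\<xi>\<^sub>i\<close> with its own index \<open>i\<close>, so the
  index is left implicit in the decoration.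
\<close>

datatype odd_var = Theta | Xi

datatype motzkin_step = Up | Hor_Theta | Hor_Xi | Down

fun step_vec :: "motzkin_step \<Rightarrow> int \<times> int" where
  "step_vec Up = (1, 1)"
| "step_vec Hor_Theta = (1, 0)"
| "step_vec Hor_Xi = (1, 0)"
| "step_vec Down = (1, -1)"

fun decoration :: "motzkin_step \<Rightarrow> odd_var set" where
  "decoration Up = {}"
| "decoration Hor_Theta = {Theta}"
| "decoration Hor_Xi = {Xi}"
| "decoration Down = {Theta, Xi}"

text \<open>A path is the list of its steps: \<open>p\<^sub>i\<close> is \<^term>\<open>\<pi> ! (i - 1)\<close>.\<close>

definition path_vertex :: "motzkin_step list \<Rightarrow> nat \<Rightarrow> int \<times> int" where
  "path_vertex \<pi> k = sum_list (map step_vec (take k \<pi>))"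

definition motzkin_paths :: "nat \<Rightarrow> motzkin_step list set" where
  "motzkin_paths n =
     {\<pi>. length \<pi> = n \<and> \<pi> \<noteq> [] \<and> hd \<pi> = Up \<and> (\<forall>k\<in>{1..n}. snd (path_vertex \<pi> k) \<ge> 1)}"

definition path_theta :: "motzkin_step list \<Rightarrow> nat set" where
  "path_theta \<pi> = {i \<in> {1..length \<pi>}. Theta \<in> decoration (\<pi> ! (i - 1))}"

definition path_xi :: "motzkin_step list \<Rightarrow> nat set" where
  "path_xi \<pi> = {i \<in> {1..length \<pi>}. Xi \<in> decoration (\<pi> ! (i - 1))}"

section \<open>The set of monomials\<close>

text \<open>
  \<open>Monomial \<alpha> T S\<close> stands for \<open>x\<^sup>\<alpha> \<theta>\<^sub>T \<xi>\<^sub>S\<close> up to sign; the exponents \<open>\<beta>\<^sub>i\<close> and \<open>\<gamma>\<^sub>i\<close> are the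
  indicators of \<open>i \<in> T\<close> and \<open>i \<in> S\<close>.
\<close>

datatype monomial =
  Monomial (x_exp: "nat \<Rightarrow> nat") (theta_set: "nat set") (xi_set: "nat set")

text \<open>The index 0 is not used; its value only makes the function total.\<close>

fun alpha_bound :: "nat set \<Rightarrow> nat set \<Rightarrow> nat \<Rightarrow> int" where
  "alpha_bound T S 0 = 0"
| "alpha_bound T S (Suc 0) = 0"
| "alpha_bound T S (Suc (Suc i)) =
     alpha_bound T S (Suc i) - 1
       + of_bool (Suc (Suc i) \<notin> T) + of_bool (Suc (Suc i) \<notin> S)"

text \<open>
  The variables are \<open>x\<^sub>1, \<dots>, x\<^sub>n\<close>. Requiring exponent 0 at all other indices makes
  the representation of a monomial unique.
\<close>

definition B12 :: "nat \<Rightarrow> monomial set" where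
  "B12 n = {Monomial \<alpha> T S | \<alpha> T S.
     (\<exists>\<pi>\<in>motzkin_paths n. T = path_theta \<pi> \<and> S = path_xi \<pi>) \<and>
     (\<forall>i\<in>{1..n}. int (\<alpha> i) \<le> alpha_bound T S i) \<and>
     (\<forall>i. i \<notin> {1..n} \<longrightarrow> \<alpha> i = 0)}"

definition deg_x :: "nat \<Rightarrow> monomial \<Rightarrow> nat" where
  "deg_x n b = (\<Sum>i=1..n. x_exp b i)"

definition deg_theta :: "nat \<Rightarrow> monomial \<Rightarrow> nat" where
  "deg_theta n b = (\<Sum>i=1..n. of_bool (i \<in> theta_set b))"

definition deg_xi :: "nat \<Rightarrow> monomial \<Rightarrow> nat" where
  "deg_xi n b = (\<Sum>i=1..n. of_bool (i \<in> xi_set b))"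

section \<open>Segmented permutations\<close>

text \<open>A segmented permutation is the list of its blocks, from left to right.\<close>

type_synonym segmented = "nat list list"

definition SW :: "nat \<Rightarrow> segmented set" where
  "SW n = {\<sigma>. concat \<sigma> \<in> permutations_of_set {1..n} \<and> [] \<notin> set \<sigma>}"

text \<open>\<open>letter \<sigma> i\<close> is \<open>\<sigma>\<^sub>i\<close>, with \<open>i\<close> counted from 1.\<close>

definition letter :: "segmented \<Rightarrow> nat \<Rightarrow> nat" where
  "letter \<sigma> i = concat \<sigma> ! (i - 1)"

text \<open>
  The letters of a segmented permutation are distinct, so blocks can be identified through
  the letters they contain.
\<close>

definition same_block :: "segmented \<Rightarrow> nat \<Rightarrow> nat \<Rightarrow> bool" where
  "same_block \<sigma> a b \<longleftrightarrow> (\<exists>B\<in>set \<sigma>. a \<in> set B \<and> b \<in> set B)"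

definition first_in_block :: "segmented \<Rightarrow> nat \<Rightarrow> bool" where
  "first_in_block \<sigma> a \<longleftrightarrow> (\<exists>B\<in>set \<sigma>. B \<noteq> [] \<and> hd B = a)"

definition ascents :: "segmented \<Rightarrow> nat set" where
  "ascents \<sigma> = {i. 1 \<le> i \<and> i < length (concat \<sigma>) \<and>
     same_block \<sigma> (letter \<sigma> i) (letter \<sigma> (i + 1)) \<and> letter \<sigma> i < letter \<sigma> (i + 1)}"

definition descents :: "segmented \<Rightarrow> nat set" where
  "descents \<sigma> = {i. 1 \<le> i \<and> i < length (concat \<sigma>) \<and>
     same_block \<sigma> (letter \<sigma> i) (letter \<sigma> (i + 1)) \<and> letter \<sigma> i > letter \<sigma> (i + 1)}"

definition sminversions :: "segmented \<Rightarrow> (nat \<times> nat) set" where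
  "sminversions \<sigma> = {(i, j). 1 \<le> i \<and> i < j \<and> j \<le> length (concat \<sigma>) \<and>
     letter \<sigma> i > letter \<sigma> j \<and>
     (first_in_block \<sigma> (letter \<sigma> j) \<or> letter \<sigma> (j - 1) > letter \<sigma> i)}"

definition sminv :: "segmented \<Rightarrow> nat" where
  "sminv \<sigma> = card (sminversions \<sigma>)"

section \<open>The insertion map\<close>

text \<open>
  \<open>insert_letter i a t s \<sigma>\<close> performs the insertion of \<open>i\<close> with \<open>\<alpha>\<^sub>i = a\<close>, where \<open>t\<close> and \<open>s\<close> say
  whether \<open>\<beta>\<^sub>i = 1\<close> and \<open>\<gamma>\<^sub>i = 1\<close>. It is \<^term>\<open>None\<close> if \<open>\<sigma>\<close> has too few blocks for
  the insertion to make sense. In a list of \<open>l\<close> blocks, the \<open>(a + 1)\<close>-st from the right has index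
  \<open>l - 1 - a\<close>; in the new-block case the resulting word has one block more than \<open>\<sigma>\<close>,
  and in the merging case one block less.
\<close>

definition insert_letter ::
    "nat \<Rightarrow> nat \<Rightarrow> bool \<Rightarrow> bool \<Rightarrow> segmented \<Rightarrow> segmented option" where
  "insert_letter i a t s \<sigma> =
     (if \<not> t \<and> \<not> s then
        (if a \<le> length \<sigma> then
           (let m = length \<sigma> - a in Some (take m \<sigma> @ [[i]] @ drop m \<sigma>))
         else None)
      else if t \<and> \<not> s then
        (if a + 1 \<le> length \<sigma> then
           (let m = length \<sigma> - 1 - a in Some (\<sigma>[m := \<sigma> ! m @ [i]]))
         else None)
      else if \<not> t \<and> s then
        (if a + 1 \<le> length \<sigma> then
           (let m = length \<sigma> - 1 - a in Some (\<sigma>[m := [i] @ \<sigma> ! m]))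
         else None)
      else
        (if a + 2 \<le> length \<sigma> then
           (let m = length \<sigma> - 2 - a in
              Some (take m \<sigma> @ [\<sigma> ! m @ [i] @ \<sigma> ! (m + 1)] @ drop (m + 2) \<sigma>))
         else None))"

definition psi :: "nat \<Rightarrow> monomial \<Rightarrow> segmented option" where
  "psi n b =
     fold (\<lambda>i r. Option.bind r (insert_letter i (x_exp b i) (i \<in> theta_set b) (i \<in> xi_set b)))
       [2..<n + 1] (Some [[1]])"

end

theory Submission
  imports Defs
begin

text \<open>
  The map \<open>\<psi>\<close> is undone by deleting the largest letter \<open>m\<close>. Writing the block of \<open>m\<close> as \<open>B m C\<close>, the
  letter was inserted with \<open>\<beta> = 1\<close> iff \<open>B\<close> is nonempty, with \<open>\<gamma> = 1\<close> iff \<open>C\<close> is nonempty, and with \<open>\<alpha>\<close>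
  the number of blocks to the right; so each insertion step is reversible. It creates the ascent
  from \<open>B\<close> to \<open>m\<close>, the descent from \<open>m\<close> to \<open>C\<close>, and one sminversion per block to the right.
  After step \<open>i\<close> there are \<open>\<alpha>\<^sub>i(T, S) + 1\<close> blocks, so the bound on \<open>\<alpha>\<^sub>i\<close> says exactly that the
  insertion is possible.
\<close>

section \<open>Pairs of letters of a word\<close>

text \<open>Pairs of letters replace pairs of positions: positions shift when a letter is inserted,
  letters do not.\<close>

fun adj :: "'a list \<Rightarrow> ('a \<times> 'a) set" where
  "adj [] = {}"
| "adj [x] = {}"
| "adj (x # y # zs) = insert (x, y) (adj (y # zs))"

fun before :: "'a list \<Rightarrow> ('a \<times> 'a) set" where
  "before [] = {}"
| "before (x # xs) = {x} \<times> set xs \<union> before xs"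

lemma adj_Cons: "adj (x # xs) = adj xs \<union> (if xs = [] then {} else {(x, hd xs)})"
  by (cases xs) auto

lemma adj_append:
  "adj (xs @ ys) = adj xs \<union> adj ys \<union> (if xs = [] \<or> ys = [] then {} else {(last xs, hd ys)})"
  by (induction xs) (auto simp: adj_Cons)

lemma adj_subset: "adj xs \<subseteq> set xs \<times> set xs"
  by (induction xs rule: adj.induct) auto

lemma adj_not_hd: "distinct xs \<Longrightarrow> (p, y) \<in> adj xs \<Longrightarrow> y \<noteq> hd xs"
  by (induction xs rule: adj.induct) (use adj_subset in \<open>fastforce+\<close>)

lemma before_append: "before (xs @ ys) = before xs \<union> before ys \<union> set xs \<times> set ys"
  by (induction xs) auto

lemma before_subset: "before xs \<subseteq> set xs \<times> set xs"
  by (induction xs) auto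

lemma adj_conv_nth: "(p, y) \<in> adj xs \<longleftrightarrow> (\<exists>i. Suc i < length xs \<and> p = xs ! i \<and> y = xs ! Suc i)"
proof (induction xs rule: adj.induct)
  case (3 x x' zs)
  show ?case (is "_ \<longleftrightarrow> (\<exists>i. ?P i)")
  proof -
    have "(\<exists>i. ?P i) \<longleftrightarrow> ?P 0 \<or> (\<exists>i. ?P (Suc i))"
      by (metis not0_implies_Suc)
    then show ?thesis using 3 by auto
  qed
qed auto

lemma before_conv_nth: "(x, y) \<in> before xs \<longleftrightarrow> (\<exists>i j. i < j \<and> j < length xs \<and> x = xs ! i \<and> y = xs ! j)"
proof (induction xs)
  case (Cons z zs)
  show ?case
  proof
    assume "(x, y) \<in> before (z # zs)"
    then consider "x = z" "y \<in> set zs" | "(x, y) \<in> before zs" by auto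
    then show "\<exists>i j. i < j \<and> j < length (z # zs) \<and> x = (z # zs) ! i \<and> y = (z # zs) ! j"
    proof cases
      case 1
      then obtain j where "j < length zs" "y = zs ! j" by (auto simp: in_set_conv_nth)
      then show ?thesis using 1 by (intro exI[of _ 0] exI[of _ "Suc j"]) auto
    next
      case 2
      then obtain i j where "i < j" "j < length zs" "x = zs ! i" "y = zs ! j"
        using Cons by auto
      then show ?thesis by (intro exI[of _ "Suc i"] exI[of _ "Suc j"]) auto
    qed
  next
    assume "\<exists>i j. i < j \<and> j < length (z # zs) \<and> x = (z # zs) ! i \<and> y = (z # zs) ! j"
    then obtain i j where ij: "i < j" "j < length (z # zs)" "x = (z # zs) ! i" "y = (z # zs) ! j"
      by blast
    then obtain j' where "j = Suc j'" by (cases j) auto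
    then show "(x, y) \<in> before (z # zs)"
      using ij Cons by (cases i) auto
  qed
qed auto

section \<open>Statistics as numbers of pairs of letters\<close>

definition block_adj :: "'a list list \<Rightarrow> ('a \<times> 'a) set" where
  "block_adj \<sigma> = (\<Union>B\<in>set \<sigma>. adj B)"

text \<open>If the predecessor of \<open>y\<close> lies across a bar, then \<open>y\<close> is a
  first letter and the other alternative applies; so only predecessors in the same block are asked
  for.\<close>

definition sminv_pairs :: "segmented \<Rightarrow> (nat \<times> nat) set" where
  "sminv_pairs \<sigma> = {(x, y) \<in> before (concat \<sigma>). y < x \<and>
     (y \<in> hd ` set \<sigma> \<or> (\<exists>p>x. (p, y) \<in> block_adj \<sigma>))}"

lemma block_adj_subset_adj: "block_adj \<sigma> \<subseteq> adj (concat \<sigma>)"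
  by (induction \<sigma>) (auto simp: block_adj_def adj_append)

lemma block_adj_subset: "block_adj \<sigma> \<subseteq> set (concat \<sigma>) \<times> set (concat \<sigma>)"
  using block_adj_subset_adj adj_subset by blast

lemma hd_image_subset: "[] \<notin> set \<sigma> \<Longrightarrow> hd ` set \<sigma> \<subseteq> set (concat \<sigma>)"
  by (metis UN_I hd_in_set image_subsetI set_concat)

text \<open>Nonempty blocks with disjoint letters have different first letters. This later counts
  the sminversions that a new maximal letter creates.\<close>

lemma card_hd_image:
  assumes "distinct (concat \<sigma>)" "[] \<notin> set \<sigma>"
  shows "card (hd ` set \<sigma>) = length \<sigma>"
  using assms
proof (induction \<sigma>)
  case (Cons B \<sigma>)
  have "hd B \<in> set B" "hd ` set \<sigma> \<subseteq> set (concat \<sigma>)"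
    using Cons.prems(2) hd_image_subset[of \<sigma>] by auto
  moreover have "set B \<inter> set (concat \<sigma>) = {}" "distinct (concat \<sigma>)" "[] \<notin> set \<sigma>"
    using Cons.prems by auto
  ultimately have "hd B \<notin> hd ` set \<sigma>" "card (hd ` set \<sigma>) = length \<sigma>"
    using Cons.IH by blast+
  then show ?case by simp
qed simp

text \<open>A bar between consecutive letters makes the second a first letter; distinctness excludes
  this inside a block. The descriptions are tied together because ascents use
  \<open>same_block\<close> and sminversions use first letters.\<close>

lemma adj_concat_cases:
  assumes "distinct (concat \<sigma>)" "[] \<notin> set \<sigma>" "(p, y) \<in> adj (concat \<sigma>)"
  shows "(p, y) \<in> block_adj \<sigma> \<and> same_block \<sigma> p y \<and> y \<notin> hd ` set \<sigma> \<or>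
    (p, y) \<notin> block_adj \<sigma> \<and> \<not> same_block \<sigma> p y \<and> y \<in> hd ` set \<sigma>"
  using assms
proof (induction \<sigma>)
  case (Cons B \<sigma>)
  have dist: "distinct B" "distinct (concat \<sigma>)" "set B \<inter> set (concat \<sigma>) = {}" and ne: "B \<noteq> []"
    using Cons.prems by auto
  have hds: "hd ` set \<sigma> \<subseteq> set (concat \<sigma>)"
    using Cons.prems(2) by (intro hd_image_subset) simp
  have sb: "same_block \<sigma> a c \<Longrightarrow> a \<in> set (concat \<sigma>) \<and> c \<in> set (concat \<sigma>)" for a c
    by (auto simp: same_block_def)
  have sb_Cons: "same_block (B # \<sigma>) p y \<longleftrightarrow> p \<in> set B \<and> y \<in> set B \<or> same_block \<sigma> p y"
    by (auto simp: same_block_def)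
  have ba_Cons: "block_adj (B # \<sigma>) = adj B \<union> block_adj \<sigma>"
    by (simp add: block_adj_def)
  consider "(p, y) \<in> adj B" | "(p, y) \<in> adj (concat \<sigma>)"
    | "concat \<sigma> \<noteq> []" "p = last B" "y = hd (concat \<sigma>)"
    using Cons.prems(3) by (auto simp: adj_append split: if_splits)
  then show ?case
  proof cases
    case 1
    then have "p \<in> set B" "y \<in> set B" "y \<noteq> hd B"
      using adj_subset adj_not_hd dist by fast+
    moreover from this have "y \<notin> hd ` set \<sigma>" using dist(3) hds by blast
    ultimately show ?thesis using 1 by (simp add: sb_Cons ba_Cons)
  next
    case 2
    then have py: "p \<in> set (concat \<sigma>)" "y \<in> set (concat \<sigma>)" using adj_subset by fast+
    then have "p \<notin> set B" "y \<notin> set B" using dist by blast+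
    moreover have "hd B \<in> set B" using ne by simp
    moreover from calculation have "(p, y) \<notin> adj B" "y \<noteq> hd B" using adj_subset by fast+
    moreover have "[] \<notin> set \<sigma>" using Cons.prems(2) by simp
    ultimately show ?thesis
      using Cons.IH[OF dist(2) _ 2] by (simp add: sb_Cons ba_Cons)
  next
    case 3
    then obtain D \<sigma>' where \<sigma>: "\<sigma> = D # \<sigma>'" by (cases \<sigma>) auto
    then have "D \<noteq> []" using Cons.prems by auto
    then have y: "y = hd D" "y \<in> set (concat \<sigma>)" using 3 \<sigma> by auto
    have "p \<in> set B" using 3 ne by simp
    then have "p \<notin> set (concat \<sigma>)" "y \<notin> set B" using y dist by blast+
    then have "\<not> same_block \<sigma> p y" "(p, y) \<notin> block_adj \<sigma>" "(p, y) \<notin> adj B"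
      using sb block_adj_subset[of \<sigma>] adj_subset[of B] by blast+
    then show ?thesis using \<open>y \<notin> set B\<close> y(1) \<sigma> unfolding sb_Cons ba_Cons by simp
  qed
qed auto

lemma same_block_adj:
  assumes "distinct (concat \<sigma>)" "[] \<notin> set \<sigma>"
  shows "(p, y) \<in> block_adj \<sigma> \<longleftrightarrow> (p, y) \<in> adj (concat \<sigma>) \<and> same_block \<sigma> p y"
  using adj_concat_cases[OF assms] block_adj_subset_adj by blast

text \<open>In a distinct word a position is recovered from its letter. \<open>R\<close> is kept
  general to serve ascents and descents alike.\<close>

lemma card_adjacent_positions:
  assumes "distinct (concat \<sigma>)" "[] \<notin> set \<sigma>"
  shows "card {i. 1 \<le> i \<and> i < length (concat \<sigma>) \<and>
      same_block \<sigma> (letter \<sigma> i) (letter \<sigma> (i + 1)) \<and> R (letter \<sigma> i) (letter \<sigma> (i + 1))}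
    = card {(p, y) \<in> block_adj \<sigma>. R p y}" (is "card ?I = card ?P")
proof -
  let ?f = "\<lambda>i. (letter \<sigma> i, letter \<sigma> (i + 1))"
  have inj: "inj_on ?f ?I"
  proof (rule inj_onI)
    fix i j assume ij: "i \<in> ?I" "j \<in> ?I" "?f i = ?f j"
    then have "i < length (concat \<sigma>)" "j < length (concat \<sigma>)" by blast+
    then show "i = j"
      using ij(3) nth_eq_iff_index_eq[OF assms(1)] by (simp add: letter_def)
  qed
  have img: "?f ` ?I = ?P"
  proof (intro equalityI subsetI)
    fix z assume "z \<in> ?f ` ?I"
    then obtain i where i: "i \<in> ?I" "z = ?f i" by blast
    then obtain k where k: "i = Suc k" by (cases i) auto
    have "(letter \<sigma> i, letter \<sigma> (i + 1)) \<in> adj (concat \<sigma>)"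
      unfolding adj_conv_nth by (rule exI[of _ k]) (use i(1) k in \<open>simp add: letter_def\<close>)
    then show "z \<in> ?P"
      using i by (simp add: same_block_adj[OF assms])
  next
    fix z assume z: "z \<in> ?P"
    then obtain p y where py: "z = (p, y)" "(p, y) \<in> block_adj \<sigma>" "R p y" by blast
    then have "(p, y) \<in> adj (concat \<sigma>)" "same_block \<sigma> p y"
      by (simp_all add: same_block_adj[OF assms])
    then obtain i where i: "Suc i < length (concat \<sigma>)" "p = concat \<sigma> ! i" "y = concat \<sigma> ! Suc i"
      unfolding adj_conv_nth by blast
    have "z = ?f (Suc i)" using i py by (simp add: letter_def)
    moreover have "Suc i \<in> ?I"
      using i py(3) \<open>same_block \<sigma> p y\<close> by (simp add: letter_def)
    ultimately show "z \<in> ?f ` ?I" by (rule image_eqI)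
  qed
  show ?thesis using card_image[OF inj] unfolding img by (rule sym)
qed

lemma sminv_eq_card_pairs:
  assumes "distinct (concat \<sigma>)" "[] \<notin> set \<sigma>"
  shows "sminv \<sigma> = card (sminv_pairs \<sigma>)"
proof -
  let ?f = "\<lambda>(i, j). (letter \<sigma> i, letter \<sigma> j)"
  have fb: "first_in_block \<sigma> y \<longleftrightarrow> y \<in> hd ` set \<sigma>" for y
    using assms(2) by (auto simp: first_in_block_def image_iff) metis+
  \<comment> \<open>Here \<open>j = Suc (Suc k)\<close>: the letter at \<open>j\<close> and its
    predecessor have the 0-based indices \<open>Suc k\<close> and \<open>k\<close> in the
    concatenated word.\<close>
  have key: "(first_in_block \<sigma> (letter \<sigma> (Suc (Suc k))) \<or> letter \<sigma> (Suc k) > x) \<longleftrightarrow>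
    (letter \<sigma> (Suc (Suc k)) \<in> hd ` set \<sigma> \<or> (\<exists>p>x. (p, letter \<sigma> (Suc (Suc k))) \<in> block_adj \<sigma>))"
    if "Suc k < length (concat \<sigma>)" for k x
  proof -
    let ?p = "concat \<sigma> ! k" and ?y = "concat \<sigma> ! Suc k"
    have a: "(?p, ?y) \<in> adj (concat \<sigma>)" using that by (auto simp: adj_conv_nth)
    \<comment> \<open>By distinctness \<open>?y\<close> has only one predecessor in the word, so the
      quantifier over \<open>p\<close> speaks about \<open>?p\<close> alone.\<close>
    have u: "p = ?p" if "(p, ?y) \<in> block_adj \<sigma>" for p
    proof -
      obtain i where "Suc i < length (concat \<sigma>)" "p = concat \<sigma> ! i" "?y = concat \<sigma> ! Suc i"
        using \<open>(p, ?y) \<in> block_adj \<sigma>\<close> block_adj_subset_adj[of \<sigma>]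
        by (meson adj_conv_nth subsetD)
      then show ?thesis
        using assms(1) \<open>Suc k < length (concat \<sigma>)\<close> by (simp add: nth_eq_iff_index_eq)
    qed
    show ?thesis
      using adj_concat_cases[OF assms a] u by (auto simp: fb letter_def)
  qed
  have "inj_on ?f (sminversions \<sigma>)"
  proof (rule inj_onI)
    fix z z' assume zz: "z \<in> sminversions \<sigma>" "z' \<in> sminversions \<sigma>" "?f z = ?f z'"
    obtain i j i' j' where z: "z = (i, j)" "z' = (i', j')" by (cases z, cases z')
    have "1 \<le> i" "i < j" "j \<le> length (concat \<sigma>)" "1 \<le> i'" "i' < j'" "j' \<le> length (concat \<sigma>)"
      using zz(1,2) z by (simp_all add: sminversions_def)
    moreover from this have "i - 1 = i' - 1" "j - 1 = j' - 1"
      using zz(3) z nth_eq_iff_index_eq[OF assms(1)] by (auto simp: letter_def)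
    ultimately show "z = z'" using z by auto
  qed
  moreover have "?f ` sminversions \<sigma> = sminv_pairs \<sigma>"
  proof (intro equalityI subsetI)
    fix z assume "z \<in> ?f ` sminversions \<sigma>"
    then obtain i j where ij: "(i, j) \<in> sminversions \<sigma>" "z = ?f (i, j)" by fast
    then have "1 \<le> i" "i < j" by (auto simp: sminversions_def)
    \<comment> \<open>From 1 \<le> i < j follows j \<ge> 2, so the letter at \<open>j\<close> has a
      predecessor and no subtraction is truncated.\<close>
    then have s: "i = Suc (i - 1)" "j = Suc (Suc (j - 2))" by linarith+
    define i' k where "i' = i - 1" and "k = j - 2"
    with s have s: "i = Suc i'" "j = Suc (Suc k)" by simp_all
    have "(letter \<sigma> i, letter \<sigma> j) \<in> before (concat \<sigma>)"
      unfolding before_conv_nth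
      by (rule exI[of _ i'], rule exI[of _ "Suc k"])
         (use ij s in \<open>auto simp: letter_def sminversions_def\<close>)
    then show "z \<in> sminv_pairs \<sigma>"
      using ij s key[of k "letter \<sigma> i"] by (auto simp: sminv_pairs_def sminversions_def)
  next
    fix z assume z: "z \<in> sminv_pairs \<sigma>"
    then obtain i j where ij: "i < j" "j < length (concat \<sigma>)" "z = (concat \<sigma> ! i, concat \<sigma> ! j)"
      by (auto simp: sminv_pairs_def before_conv_nth)
    then obtain k where k: "j = Suc k" by (cases j) auto
    have "z = ?f (Suc i, Suc (Suc k))" using ij k by (simp add: letter_def)
    moreover from this have "(Suc i, Suc (Suc k)) \<in> sminversions \<sigma>"
      using z ij k key[of k "letter \<sigma> (Suc i)"] by (auto simp: sminversions_def sminv_pairs_def)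
    ultimately show "z \<in> ?f ` sminversions \<sigma>" by (rule image_eqI)
  qed
  ultimately show ?thesis unfolding sminv_def by (metis card_image)
qed

section \<open>Insertion of a maximal letter\<close>

text \<open>
  The four kinds of insertion are the four possibilities for the parts \<open>B\<close>, \<open>C\<close> of the block of
  the new letter \<open>m\<close> to be empty or not.
\<close>

inductive inserted ::
    "nat \<Rightarrow> nat \<Rightarrow> bool \<Rightarrow> bool \<Rightarrow> segmented \<Rightarrow> segmented \<Rightarrow> bool" for m where
  "inserted m (length R) (B \<noteq> []) (C \<noteq> [])
     (L @ filter (\<lambda>X. X \<noteq> []) [B, C] @ R) (L @ [B @ m # C] @ R)"

text \<open>Take for \<open>B\<close> the old block to whose end the letter is attached, for
  \<open>C\<close> the one to whose front it is attached, and \<open>[]\<close> where there is none.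
  As old blocks are nonempty, \<open>t\<close> and \<open>s\<close> say which of them exist.\<close>

lemma insert_letter_imp_inserted:
  assumes "insert_letter m a t s \<sigma> = Some \<tau>" "[] \<notin> set \<sigma>"
  shows "inserted m a t s \<sigma> \<tau>"
proof -
  consider "\<not> t" "\<not> s" | "t" "\<not> s" | "\<not> t" "s" | "t" "s" by blast
  then show ?thesis
  proof cases
    case 1
    define k where "k = length \<sigma> - a"
    have "a \<le> length \<sigma>" "\<tau> = take k \<sigma> @ [[m]] @ drop k \<sigma>"
      using 1 assms by (auto simp: insert_letter_def k_def Let_def split: if_splits)
    then show ?thesis
      using inserted.intros[of m "drop k \<sigma>" "[]" "[]" "take k \<sigma>"] 1 by (simp add: k_def)
  next
    case 2
    define k where "k = length \<sigma> - 1 - a"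
    have a: "a + 1 \<le> length \<sigma>" "\<tau> = \<sigma>[k := \<sigma> ! k @ [m]]"
      using 2 assms by (auto simp: insert_letter_def k_def Let_def split: if_splits)
    then have k: "k < length \<sigma>" by (simp add: k_def)
    then have "\<sigma> ! k \<noteq> []" using assms(2) by (metis nth_mem)
    then show ?thesis
      using inserted.intros[of m "drop (Suc k) \<sigma>" "\<sigma> ! k" "[]" "take k \<sigma>"] 2 a k
      by (simp add: upd_conv_take_nth_drop Cons_nth_drop_Suc) (simp add: k_def)
  next
    case 3
    define k where "k = length \<sigma> - 1 - a"
    have a: "a + 1 \<le> length \<sigma>" "\<tau> = \<sigma>[k := [m] @ \<sigma> ! k]"
      using 3 assms by (auto simp: insert_letter_def k_def Let_def split: if_splits)
    then have k: "k < length \<sigma>" by (simp add: k_def)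
    then have "\<sigma> ! k \<noteq> []" using assms(2) by (metis nth_mem)
    then show ?thesis
      using inserted.intros[of m "drop (Suc k) \<sigma>" "[]" "\<sigma> ! k" "take k \<sigma>"] 3 a k
      by (simp add: upd_conv_take_nth_drop Cons_nth_drop_Suc) (simp add: k_def)
  next
    case 4
    \<comment> \<open>Index of the left one of the two merged blocks; \<open>a\<close> blocks remain
      to the right of the pair.\<close>
    define k where "k = length \<sigma> - 2 - a"
    have a: "a + 2 \<le> length \<sigma>"
      "\<tau> = take k \<sigma> @ [\<sigma> ! k @ [m] @ \<sigma> ! Suc k] @ drop (Suc (Suc k)) \<sigma>"
      using 4 assms by (auto simp: insert_letter_def k_def Let_def split: if_splits)
    then have k: "Suc k < length \<sigma>" by (simp add: k_def)
    then have "\<sigma> ! k \<noteq> []" "\<sigma> ! Suc k \<noteq> []" using assms(2) by (metis Suc_lessD nth_mem)+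
    then show ?thesis
      using inserted.intros[of m "drop (Suc (Suc k)) \<sigma>" "\<sigma> ! k" "\<sigma> ! Suc k" "take k \<sigma>"] 4 a k
      by (simp add: Cons_nth_drop_Suc) (simp add: k_def Suc_diff_Suc numeral_2_eq_2)
  qed
qed

lemma inserted_imp_insert_letter:
  assumes "inserted m a t s \<sigma> \<tau>"
  shows "insert_letter m a t s \<sigma> = Some \<tau>"
  using assms
proof cases
  case (1 R B C L)
  then show ?thesis
    by (auto simp: insert_letter_def Let_def nth_append list_update_append)
qed

section \<open>Number of blocks\<close>

text \<open>With l blocks the four guards bound \<open>a\<close> by l, l - 1, l - 1 and l - 2. The
  common formula, over the integers since l - 2 may be negative, is the recursion of
  \<open>alpha_bound\<close> applied to l - 1.\<close>

lemma insert_letter_defined_iff: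
  "insert_letter m a t s \<sigma> \<noteq> None \<longleftrightarrow>
     int a \<le> int (length \<sigma>) - 2 + of_bool (\<not> t) + of_bool (\<not> s)"
  by (auto simp: insert_letter_def Let_def)

lemma inserted_length:
  "inserted m a t s \<sigma> \<tau> \<Longrightarrow>
     int (length \<tau>) = int (length \<sigma>) - 1 + of_bool (\<not> t) + of_bool (\<not> s)"
  by (auto elim!: inserted.cases)

section \<open>Recovering the previous word\<close>

text \<open>Serves at two levels: cutting a block at the new letter, and cutting the list of blocks
  at the block of that letter.\<close>

lemma split_unique:
  assumes "xs @ y # zs = xs' @ y # zs'" "y \<notin> set xs" "y \<notin> set xs'"
  shows "xs = xs' \<and> zs = zs'"
  using assms
proof (induction xs arbitrary: xs')
  case Nil
  then show ?case by (cases xs') auto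
next
  case (Cons x xs)
  then show ?case by (cases xs') auto
qed

text \<open>Since \<open>m\<close> occurs only once, the word determines its block, the parts
  \<open>B\<close> and \<open>C\<close> around it, and the blocks \<open>L\<close> and
  \<open>R\<close> on either side; these give all other data.\<close>

lemma inserted_unique:
  assumes "inserted m a t s \<sigma> \<tau>" "inserted m a' t' s' \<sigma>' \<tau>" "distinct (concat \<tau>)"
  shows "a = a' \<and> t = t' \<and> s = s' \<and> \<sigma> = \<sigma>'"
  using assms(1)
proof cases
  case i: (1 R B C L)
  from assms(2) show ?thesis
  proof cases
    case i': (1 R' B' C' L')
    have "concat \<tau> = concat L @ B @ m # C @ concat R"
      "concat \<tau> = concat L' @ B' @ m # C' @ concat R'"
      by (simp add: i(5), simp add: i'(5))
    then have blocks: "distinct (concat L @ B @ m # C @ concat R)"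
      "distinct (concat L' @ B' @ m # C' @ concat R')"
      using assms(3) by metis+
    have same: "X = Y" if "X \<in> set \<tau>" "Y \<in> set \<tau>" "m \<in> set X" "m \<in> set Y" for X Y
      using that assms(3) by (metis disjoint_iff distinct_concat_iff)
    have eq: "B @ m # C = B' @ m # C'"
      by (rule same) (simp add: i(5), simp add: i'(5), simp_all)
    then have BC: "B = B'" "C = C'" using split_unique[of B m C B' C'] blocks by auto
    let ?D = "B @ m # C"
    have "L @ ?D # R = L' @ ?D # R'" using i(5) i'(5) eq by simp
    moreover have "?D \<notin> set L" "?D \<notin> set L'" using blocks eq by auto
    ultimately have "L = L'" "R = R'" using split_unique[of L ?D R L' R'] by auto
    then show ?thesis using i i' BC by simp
  qed
qed

text \<open>Splitting at an occurrence of \<open>m\<close> already has the required shape; this is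
  the deletion behind surjectivity.\<close>

lemma inserted_exists:
  assumes "m \<in> set (concat \<tau>)"
  shows "\<exists>a t s \<sigma>. inserted m a t s \<sigma> \<tau>"
proof -
  obtain D where "D \<in> set \<tau>" "m \<in> set D" using assms by auto
  then obtain B C L R where "D = B @ m # C" "\<tau> = L @ D # R" by (meson split_list)
  then show ?thesis using inserted.intros[of m R B C L] by auto
qed

lemma SW_iff:
  "\<sigma> \<in> SW n \<longleftrightarrow> set (concat \<sigma>) = {1..n} \<and> distinct (concat \<sigma>) \<and> [] \<notin> set \<sigma>"
  by (auto simp: SW_def permutations_of_set_def)

text \<open>The words differ by one occurrence of \<open>Suc n\<close>, and empty parts are filtered
  out. From right to left this keeps \<open>psi\<close> inside \<open>SW\<close>; from left to right
  it lets surjectivity descend to length \<open>n\<close>.\<close>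

lemma inserted_SW_iff:
  assumes "inserted (Suc n) a t s \<sigma> \<tau>"
  shows "\<tau> \<in> SW (Suc n) \<longleftrightarrow> \<sigma> \<in> SW n"
  using assms
proof cases
  case (1 R B C L)
  define A where "A = concat L @ B @ C @ concat R"
  have \<sigma>: "concat \<sigma> = A" and \<tau>: "concat \<tau> = (concat L @ B) @ Suc n # (C @ concat R)"
    by (auto simp: 1 A_def)
  have ne: "[] \<in> set \<sigma> \<longleftrightarrow> [] \<in> set \<tau>" by (auto simp: 1)
  have set: "set (concat \<tau>) = insert (Suc n) (set A)"
    and dist: "distinct (concat \<tau>) \<longleftrightarrow> Suc n \<notin> set A \<and> distinct A"
    unfolding \<tau> A_def by auto
  have "insert (Suc n) (set A) = {1..Suc n} \<and> Suc n \<notin> set A \<longleftrightarrow> set A = {1..n}"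
  proof -
    have "{1..Suc n} = insert (Suc n) {1..n}" "Suc n \<notin> {1..n}" by auto
    then show ?thesis by (metis insert_ident)
  qed
  then show ?thesis unfolding SW_iff set dist ne \<sigma> by blast
qed

section \<open>Change of the statistics under an insertion\<close>

lemma finite_block_adj: "finite (block_adj \<sigma>)"
  unfolding block_adj_def by (auto intro: finite_subset[OF adj_subset])

text \<open>No pair is lost: when \<open>B\<close> and \<open>C\<close> are both nonempty, a bar
  stood between \<open>last B\<close> and \<open>hd C\<close>.\<close>

lemma block_adj_inserted:
  "block_adj (L @ [B @ m # C] @ R) = block_adj (L @ filter (\<lambda>X. X \<noteq> []) [B, C] @ R) \<union>
     (if B = [] then {} else {(last B, m)}) \<union> (if C = [] then {} else {(m, hd C)})"
  by (auto simp: block_adj_def adj_append adj_Cons)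

lemma inserted_adjacent:
  assumes "inserted m a t s \<sigma> \<tau>" "\<forall>x\<in>set (concat \<sigma>). x < m"
  shows "card {(p, y) \<in> block_adj \<tau>. p < y} = card {(p, y) \<in> block_adj \<sigma>. p < y} + of_bool t"
    and "card {(p, y) \<in> block_adj \<tau>. p > y} = card {(p, y) \<in> block_adj \<sigma>. p > y} + of_bool s"
proof -
  from assms(1) obtain R B C L where 1: "t = (B \<noteq> [])" "s = (C \<noteq> [])"
    "\<sigma> = L @ filter (\<lambda>X. X \<noteq> []) [B, C] @ R" "\<tau> = L @ [B @ m # C] @ R"
    by cases
  have BC: "set B \<subseteq> set (concat \<sigma>)" "set C \<subseteq> set (concat \<sigma>)" by (auto simp: 1)
  have ba: "block_adj \<tau> = block_adj \<sigma> \<union>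
      (if B = [] then {} else {(last B, m)}) \<union> (if C = [] then {} else {(m, hd C)})"
    unfolding 1 by (rule block_adj_inserted)
  \<comment> \<open>The letter \<open>m\<close> does not occur in the old word, so the added pairs
    really increase the count.\<close>
  have new: "(p, m) \<notin> block_adj \<sigma>" "(m, p) \<notin> block_adj \<sigma>" for p
    using block_adj_subset assms(2) by blast+
  have less: "B \<noteq> [] \<Longrightarrow> last B < m" "C \<noteq> [] \<Longrightarrow> hd C < m"
    using BC assms(2) by (meson last_in_set hd_in_set subsetD)+
  have fin: "finite {(p, y) \<in> block_adj \<sigma>. p < y}" "finite {(p, y) \<in> block_adj \<sigma>. p > y}"
    by (auto intro: finite_subset[OF _ finite_block_adj])
  have "{(p, y) \<in> block_adj \<tau>. p < y} =
      {(p, y) \<in> block_adj \<sigma>. p < y} \<union> (if B = [] then {} else {(last B, m)})"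
    unfolding ba using less by auto
  then show "card {(p, y) \<in> block_adj \<tau>. p < y} = card {(p, y) \<in> block_adj \<sigma>. p < y} + of_bool t"
    using fin new by (simp add: 1(1,2))
  have "{(p, y) \<in> block_adj \<tau>. p > y} =
      {(p, y) \<in> block_adj \<sigma>. p > y} \<union> (if C = [] then {} else {(m, hd C)})"
    unfolding ba using less by auto
  then show "card {(p, y) \<in> block_adj \<tau>. p > y} = card {(p, y) \<in> block_adj \<sigma>. p > y} + of_bool s"
    using fin new by (simp add: 1(1,2))
qed

text \<open>
  The new letter exceeds all others, so an old pair keeps its status: where a first letter of a
  block loses that role, its new predecessor is \<open>m\<close>. The new pairs are \<open>m\<close> with the first letters
  of the blocks to its right.
\<close>

lemma inserted_sminv_pairs:
  assumes "inserted m a t s \<sigma> \<tau>" "\<forall>x\<in>set (concat \<sigma>). x < m" "distinct (concat \<sigma>)" "[] \<notin> set \<sigma>"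
  shows "card (sminv_pairs \<tau>) = card (sminv_pairs \<sigma>) + a"
proof -
  from assms(1) obtain R B C L where 1: "a = length R"
    "\<sigma> = L @ filter (\<lambda>X. X \<noteq> []) [B, C] @ R" "\<tau> = L @ [B @ m # C] @ R"
    by cases
  \<comment> \<open>The letters before and after \<open>m\<close>, with bars ignored.\<close>
  define U V where "U = concat L @ B" and "V = C @ concat R"
  have \<sigma>: "concat \<sigma> = U @ V" and \<tau>: "concat \<tau> = U @ m # V" by (auto simp: 1 U_def V_def)
  have small: "x < m" if "x \<in> set U \<or> x \<in> set V" for x using that assms(2) \<sigma> by auto
  have UV: "set U \<inter> set V = {}" using assms(3) \<sigma> by auto
  have ne: "[] \<notin> set L" "[] \<notin> set R" using assms(4) by (auto simp: 1)
  have R: "hd ` set R \<subseteq> set V" and L: "hd ` set L \<subseteq> set U"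
    using hd_image_subset ne by (fastforce simp: U_def V_def)+
  have B: "B \<noteq> [] \<Longrightarrow> hd B \<in> set U"
    by (auto simp: U_def)
  have ba: "block_adj \<tau> = block_adj \<sigma> \<union>
      (if B = [] then {} else {(last B, m)}) \<union> (if C = [] then {} else {(m, hd C)})"
    unfolding 1 by (rule block_adj_inserted)
  \<comment> \<open>No predecessor exceeds the maximal letter \<open>m\<close>, so an sminversion
    starting at \<open>m\<close> can only end in a first letter.\<close>
  have bat: "\<not> p > m" if "(p, y) \<in> block_adj \<tau>" for p y
  proof -
    have "p \<in> set (U @ m # V)" using that block_adj_subset[of \<tau>] unfolding \<tau> by blast
    then have "p = m \<or> p < m" using small by simp blast
    then show ?thesis by linarith
  qed
  have be\<tau>: "before (concat \<tau>) = before (concat \<sigma>) \<union> {m} \<times> set V \<union> set U \<times> {m}"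
    unfolding \<sigma> \<tau> by (auto simp: before_append)
  have be\<sigma>: "before (concat \<sigma>) \<subseteq> (set U \<union> set V) \<times> (set U \<union> set V)"
    using before_subset[of "concat \<sigma>"] unfolding \<sigma> by simp
  have hd\<tau>: "hd ` set \<tau> = hd ` set L \<union> {if B = [] then m else hd B} \<union> hd ` set R"
    by (auto simp: 1)
  have hd\<sigma>: "hd ` set \<sigma> = hd ` set L \<union> (if B = [] then {} else {hd B}) \<union>
      (if C = [] then {} else {hd C}) \<union> hd ` set R"
    by (auto simp: 1)
  have m: "m \<notin> set U \<union> set V" using small by blast
  have old: "(y \<in> hd ` set \<tau> \<or> (\<exists>p>x. (p, y) \<in> block_adj \<tau>)) \<longleftrightarrow>
      (y \<in> hd ` set \<sigma> \<or> (\<exists>p>x. (p, y) \<in> block_adj \<sigma>))" if "x < m" "y < m" for x y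
    unfolding hd\<tau> hd\<sigma> ba using that by auto
  have new: "(y \<in> hd ` set \<tau> \<or> (\<exists>p>m. (p, y) \<in> block_adj \<tau>)) \<longleftrightarrow> y \<in> hd ` set R"
    if "y \<in> set V" for y
      proof -
    \<comment> \<open>Left of \<open>R\<close>, a first letter lies in \<open>U\<close> or is
      \<open>m\<close> itself, which begins its block if \<open>B\<close> is empty.\<close>
    have "y \<notin> hd ` set L" "y \<noteq> (if B = [] then m else hd B)"
      using that L B UV m by (auto split: if_splits)
    then show ?thesis unfolding hd\<tau> using bat[of _ y] by blast
  qed
  have "sminv_pairs \<tau> = sminv_pairs \<sigma> \<union> {m} \<times> hd ` set R"
  proof (intro set_eqI)
    fix z :: "nat \<times> nat"
    obtain x y where z: "z = (x, y)" by (cases z)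
    consider "(x, y) \<in> before (concat \<sigma>)" | "x = m" "y \<in> set V" | "y = m" "x \<in> set U"
      | "(x, y) \<notin> before (concat \<tau>)"
      unfolding be\<tau> by blast
    then show "z \<in> sminv_pairs \<tau> \<longleftrightarrow> z \<in> sminv_pairs \<sigma> \<union> {m} \<times> hd ` set R"
    proof cases
      case 1
      then have "x < m" "y < m" using be\<sigma> small by blast+
      then show ?thesis using 1 old[of x y] by (simp add: z sminv_pairs_def be\<tau>)
    next
      case 2
      then have "(x, y) \<notin> before (concat \<sigma>)" using be\<sigma> m by blast
      then show ?thesis using 2 new[of y] small[of y] by (simp add: z sminv_pairs_def be\<tau>)
    next
      case 3
      then have "(x, y) \<notin> before (concat \<sigma>)" "y \<notin> hd ` set R" using be\<sigma> m R by blast+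
      then show ?thesis using 3 small[of x] by (simp add: z sminv_pairs_def)
    next
      case 4
      then have "(x, y) \<notin> {m} \<times> hd ` set R" "(x, y) \<notin> before (concat \<sigma>)"
        using R unfolding be\<tau> by blast+
      then show ?thesis using 4 by (simp add: z sminv_pairs_def)
    qed
  qed
  moreover have "finite (sminv_pairs \<sigma>)"
  proof (rule finite_subset)
    show "sminv_pairs \<sigma> \<subseteq> before (concat \<sigma>)" by (auto simp: sminv_pairs_def)
    show "finite (before (concat \<sigma>))" by (rule finite_subset[OF before_subset]) simp
  qed
  moreover have "sminv_pairs \<sigma> \<inter> {m} \<times> hd ` set R = {}"
  proof -
    have "sminv_pairs \<sigma> \<subseteq> before (concat \<sigma>)" by (auto simp: sminv_pairs_def)
    then show ?thesis using be\<sigma> m by blast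
  qed
  moreover have "card (hd ` set R) = length R"
    using assms(3) ne by (intro card_hd_image) (auto simp: \<sigma> V_def)
  ultimately show ?thesis
    by (simp add: card_Un_disjoint card_cartesian_product 1(1))
qed

lemma inserted_statistics:
  assumes "inserted (Suc n) a t s \<sigma> \<tau>" "\<sigma> \<in> SW n"
  shows "sminv \<tau> = sminv \<sigma> + a"
    and "card (ascents \<tau>) = card (ascents \<sigma>) + of_bool t"
    and "card (descents \<tau>) = card (descents \<sigma>) + of_bool s"
proof -
  have "\<tau> \<in> SW (Suc n)" using inserted_SW_iff assms by blast
  then have \<tau>: "distinct (concat \<tau>)" "[] \<notin> set \<tau>" by (auto simp: SW_iff)
  have \<sigma>: "distinct (concat \<sigma>)" "[] \<notin> set \<sigma>" "\<forall>x\<in>set (concat \<sigma>). x < Suc n"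
    using assms(2) unfolding SW_iff by auto
  show "sminv \<tau> = sminv \<sigma> + a"
    using inserted_sminv_pairs[OF assms(1) \<sigma>(3,1,2)]
    by (simp only: sminv_eq_card_pairs[OF \<tau>] sminv_eq_card_pairs[OF \<sigma>(1,2)])
  show "card (ascents \<tau>) = card (ascents \<sigma>) + of_bool t"
    unfolding ascents_def card_adjacent_positions[OF \<tau>] card_adjacent_positions[OF \<sigma>(1,2)]
    by (rule inserted_adjacent[OF assms(1) \<sigma>(3)])
  show "card (descents \<tau>) = card (descents \<sigma>) + of_bool s"
    unfolding descents_def card_adjacent_positions[OF \<tau>, of "\<lambda>p y. p > y"]
      card_adjacent_positions[OF \<sigma>(1,2), of "\<lambda>p y. p > y"]
    by (rule inserted_adjacent[OF assms(1) \<sigma>(3)])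
qed

section \<open>The map \<open>\<psi>\<close>\<close>

lemma psi_1: "psi (Suc 0) b = Some [[1]]"
  by (simp add: psi_def)

lemma psi_Suc:
  "n \<ge> 1 \<Longrightarrow> psi (Suc n) b =
    Option.bind (psi n b) (insert_letter (Suc n) (x_exp b (Suc n)) (Suc n \<in> theta_set b) (Suc n \<in> xi_set b))"
  by (simp add: psi_def)

lemma SW_1: "SW (Suc 0) = {[[1]]}"
proof (intro equalityI subsetI)
  fix \<sigma> assume "\<sigma> \<in> SW (Suc 0)"
  then have \<sigma>: "set (concat \<sigma>) = {1}" "distinct (concat \<sigma>)" "[] \<notin> set \<sigma>"
    unfolding SW_iff by auto
  have "length (concat \<sigma>) = 1" using \<sigma>(1,2) distinct_card by fastforce
  then have "concat \<sigma> = [1]" using \<sigma>(1) by (cases "concat \<sigma>") auto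
  then show "\<sigma> \<in> {[[1]]}" using \<sigma>(3)
    by (cases \<sigma>) (auto simp: append_eq_Cons_conv, metis list.set_intros(1) neq_Nil_conv)
qed (simp add: SW_iff)

text \<open>Membership in \<open>SW n\<close> enters as an assumption, so that the rule can be used
  in the induction proving \<open>psi_SW\<close> itself.\<close>

lemma psi_Suc_SomeE:
  assumes "psi (Suc n) b = Some \<tau>" "n \<ge> 1" "\<And>\<sigma>. psi n b = Some \<sigma> \<Longrightarrow> \<sigma> \<in> SW n"
  obtains \<sigma> where "psi n b = Some \<sigma>" "\<sigma> \<in> SW n"
    "inserted (Suc n) (x_exp b (Suc n)) (Suc n \<in> theta_set b) (Suc n \<in> xi_set b) \<sigma> \<tau>"
proof -
  obtain \<sigma> where "psi n b = Some \<sigma>"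
    "insert_letter (Suc n) (x_exp b (Suc n)) (Suc n \<in> theta_set b) (Suc n \<in> xi_set b) \<sigma> = Some \<tau>"
    using assms(1) unfolding psi_Suc[OF assms(2)] by (auto simp: bind_eq_Some_conv)
  then show ?thesis
    using that assms(3) insert_letter_imp_inserted SW_iff by blast
qed

lemma psi_SW: "n \<ge> 1 \<Longrightarrow> psi n b = Some \<sigma> \<Longrightarrow> \<sigma> \<in> SW n"
proof (induction n arbitrary: \<sigma> rule: nat_induct_at_least)
  case base
  then show ?case by (simp add: psi_1 SW_1)
next
  case (Suc n)
  then show ?case by (metis psi_Suc_SomeE inserted_SW_iff)
qed

section \<open>Domain of \<open>psi\<close>\<close>

lemma alpha_bound_Suc:
  "n \<ge> 1 \<Longrightarrow> alpha_bound T S (Suc n) =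
    alpha_bound T S n - 1 + of_bool (Suc n \<notin> T) + of_bool (Suc n \<notin> S)"
  by (cases n) auto

text \<open>Each insertion changes both sides by the same amount, and both are 1 for the initial
  word \<open>[[1]]\<close>.\<close>

lemma psi_length:
  "n \<ge> 1 \<Longrightarrow> psi n b = Some \<sigma> \<Longrightarrow>
    int (length \<sigma>) = alpha_bound (theta_set b) (xi_set b) n + 1"
proof (induction n arbitrary: \<sigma> rule: nat_induct_at_least)
  case base
  then show ?case by (auto simp: psi_1)
next
  case (Suc n)
  from Suc.prems Suc.hyps psi_SW obtain \<sigma>' where "psi n b = Some \<sigma>'"
    "inserted (Suc n) (x_exp b (Suc n)) (Suc n \<in> theta_set b) (Suc n \<in> xi_set b) \<sigma>' \<sigma>"
    by (metis psi_Suc_SomeE)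
  then show ?case using Suc.IH[of \<sigma>'] inserted_length alpha_bound_Suc[OF Suc.hyps] by fastforce
qed

text \<open>A failed insertion makes all later results \<open>None\<close>, so definedness is the
  conjunction of the guards, which \<open>psi_length\<close> turns into the bounds. Index 1 is
  absent because the letter 1 is the starting word.\<close>

lemma psi_defined_iff:
  "n \<ge> 1 \<Longrightarrow> psi n b \<noteq> None \<longleftrightarrow>
    (\<forall>i\<in>{2..n}. int (x_exp b i) \<le> alpha_bound (theta_set b) (xi_set b) i)"
proof (induction n rule: nat_induct_at_least)
  case base
  then show ?case by (simp add: psi_1)
next
  case (Suc n)
  have 1: "{2..Suc n} = insert (Suc n) {2..n}" using Suc.hyps by auto
  show ?case
  proof (cases "psi n b")
    case None
    then show ?thesis using Suc unfolding 1 by (simp add: psi_Suc)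
  next
    case (Some \<sigma>)
    have "insert_letter (Suc n) (x_exp b (Suc n)) (Suc n \<in> theta_set b) (Suc n \<in> xi_set b) \<sigma> \<noteq> None
        \<longleftrightarrow> int (x_exp b (Suc n)) \<le> alpha_bound (theta_set b) (xi_set b) (Suc n)"
      unfolding insert_letter_defined_iff psi_length[OF Suc.hyps Some] alpha_bound_Suc[OF Suc.hyps]
      by (simp add: algebra_simps)
    then show ?thesis using Suc Some unfolding 1 by (simp add: psi_Suc)
  qed
qed

lemma psi_statistics:
  "n \<ge> 1 \<Longrightarrow> psi n b = Some \<sigma> \<Longrightarrow>
    sminv \<sigma> = (\<Sum>i=2..n. x_exp b i) \<and>
    card (ascents \<sigma>) = (\<Sum>i=2..n. of_bool (i \<in> theta_set b)) \<and>
    card (descents \<sigma>) = (\<Sum>i=2..n. of_bool (i \<in> xi_set b))"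
proof (induction n arbitrary: \<sigma> rule: nat_induct_at_least)
  case base
  then have "\<sigma> = [[1]]" by (simp add: psi_1)
  then have "sminversions \<sigma> = {}" "ascents \<sigma> = {}" "descents \<sigma> = {}"
    by (auto simp: sminversions_def ascents_def descents_def)
  then show ?case by (simp add: sminv_def)
next
  case (Suc n)
  from Suc.prems Suc.hyps psi_SW obtain \<sigma>' where \<sigma>': "psi n b = Some \<sigma>'" "\<sigma>' \<in> SW n"
    "inserted (Suc n) (x_exp b (Suc n)) (Suc n \<in> theta_set b) (Suc n \<in> xi_set b) \<sigma>' \<sigma>"
    by (metis psi_Suc_SomeE)
  have "2 \<le> Suc n" using Suc.hyps by simp
  then show ?case
    using Suc.IH[OF \<sigma>'(1)] inserted_statistics[OF \<sigma>'(3,2)]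
    by (simp add: sum.cl_ivl_Suc)
qed

section \<open>Injectivity and surjectivity of \<open>psi\<close>\<close>

text \<open>By \<open>inserted_unique\<close> the word determines the last insertion and the word
  before it; induction recovers the rest. \<open>psi\<close> reads only the indices from 2 to
  \<open>n\<close>, hence the range of \<open>i\<close>.\<close>

lemma psi_inj:
  "n \<ge> 1 \<Longrightarrow> psi n b = Some \<sigma> \<Longrightarrow> psi n b' = Some \<sigma> \<Longrightarrow> i \<in> {2..n} \<Longrightarrow>
    x_exp b i = x_exp b' i \<and> (i \<in> theta_set b \<longleftrightarrow> i \<in> theta_set b') \<and> (i \<in> xi_set b \<longleftrightarrow> i \<in> xi_set b')"
proof (induction n arbitrary: \<sigma> rule: nat_induct_at_least)
  case (Suc n)
  from Suc.prems(1) Suc.hyps psi_SW obtain \<sigma>1 where 1: "psi n b = Some \<sigma>1"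
    "inserted (Suc n) (x_exp b (Suc n)) (Suc n \<in> theta_set b) (Suc n \<in> xi_set b) \<sigma>1 \<sigma>"
    by (metis psi_Suc_SomeE)
  from Suc.prems(2) Suc.hyps psi_SW obtain \<sigma>2 where 2: "psi n b' = Some \<sigma>2"
    "inserted (Suc n) (x_exp b' (Suc n)) (Suc n \<in> theta_set b') (Suc n \<in> xi_set b') \<sigma>2 \<sigma>"
    by (metis psi_Suc_SomeE)
  have "distinct (concat \<sigma>)" using psi_SW[OF _ Suc.prems(1)] SW_iff by simp
  note eq = inserted_unique[OF 1(2) 2(2) this]
  show ?case
  proof (cases "i = Suc n")
    case False
    then show ?thesis using Suc.IH[of \<sigma>1] 1 2 eq Suc.prems(3) by auto
  qed (use eq in simp)
qed simp

text \<open>Lets the data of a new index be added without disturbing the insertions already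
  made.\<close>

lemma psi_cong:
  assumes "\<And>i. i \<in> {2..n} \<Longrightarrow> x_exp b i = x_exp b' i \<and>
    (i \<in> theta_set b \<longleftrightarrow> i \<in> theta_set b') \<and> (i \<in> xi_set b \<longleftrightarrow> i \<in> xi_set b')"
  shows "psi n b = psi n b'"
  unfolding psi_def by (rule fold_cong) (use assms in \<open>auto intro!: ext\<close>)

text \<open>Delete the largest letter and record how it was attached. The support conditions are
  carried along because \<open>B12_iff\<close> asks for them.\<close>

lemma psi_surj:
  "n \<ge> 1 \<Longrightarrow> \<sigma> \<in> SW n \<Longrightarrow>
    \<exists>\<alpha> T S. psi n (Monomial \<alpha> T S) = Some \<sigma> \<and> T \<subseteq> {2..n} \<and> S \<subseteq> {2..n} \<and> (\<forall>i. i \<notin> {2..n} \<longrightarrow> \<alpha> i = 0)"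
proof (induction n arbitrary: \<sigma> rule: nat_induct_at_least)
  case base
  then show ?case
    by (intro exI[of _ "\<lambda>_. 0"] exI[of _ "{}"]) (auto simp: psi_1 SW_1)
next
  case (Suc n)
  have "Suc n \<in> set (concat \<sigma>)" using Suc.prems unfolding SW_iff by auto
  then obtain a t s \<sigma>' where ins: "inserted (Suc n) a t s \<sigma>' \<sigma>" using inserted_exists by blast
  then have "\<sigma>' \<in> SW n" using inserted_SW_iff Suc.prems by blast
  then obtain \<alpha> T S where b: "psi n (Monomial \<alpha> T S) = Some \<sigma>'" "T \<subseteq> {2..n}" "S \<subseteq> {2..n}"
    "\<forall>i. i \<notin> {2..n} \<longrightarrow> \<alpha> i = 0"
    using Suc.IH by blast
  define \<alpha>' T' S' where "\<alpha>' = \<alpha>(Suc n := a)"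
    and "T' = (if t then insert (Suc n) T else T)" and "S' = (if s then insert (Suc n) S else S)"
  have "psi n (Monomial \<alpha>' T' S') = psi n (Monomial \<alpha> T S)"
    by (rule psi_cong) (auto simp: \<alpha>'_def T'_def S'_def)
  \<comment> \<open>As \<open>T\<close> and \<open>S\<close> stay within \<open>{2..n}\<close>, the
    new index belongs to \<open>T'\<close> or \<open>S'\<close> only if \<open>t\<close> or
    \<open>s\<close> put it there.\<close>
  moreover have "\<alpha>' (Suc n) = a" "(Suc n \<in> T') = t" "(Suc n \<in> S') = s"
    using b(2,3) by (auto simp: \<alpha>'_def T'_def S'_def)
  ultimately have "psi (Suc n) (Monomial \<alpha>' T' S') = Some \<sigma>"
    using b(1) inserted_imp_insert_letter[OF ins] by (simp add: psi_Suc[OF Suc.hyps])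
  moreover have "T' \<subseteq> {2..Suc n}" "S' \<subseteq> {2..Suc n}"
    using b(2,3) Suc.hyps by (auto simp: T'_def S'_def)
  moreover have "\<alpha>' i = 0" if "i \<notin> {2..Suc n}" for i
    using that b(4) Suc.hyps by (auto simp: \<alpha>'_def)
  ultimately show ?case by blast
qed

section \<open>Monomials and paths\<close>

text \<open>The initial up-step gives height 1 = 0 + 1, and every later step changes the height by 1
  minus the number of its decorations, as in \<open>alpha_bound\<close>. By
  \<open>psi_length\<close> the height is thus the number of blocks wherever \<open>psi\<close> is
  defined.\<close>

lemma snd_path_vertex:
  assumes "hd \<pi> = Up" "1 \<le> k" "k \<le> length \<pi>"
  shows "snd (path_vertex \<pi> k) = alpha_bound (path_theta \<pi>) (path_xi \<pi>) k + 1"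
  using assms(2,3)
proof (induction k rule: nat_induct_at_least)
  case base
  then obtain \<pi>' where "\<pi> = Up # \<pi>'" using assms(1) by (cases \<pi>) auto
  then show ?case by (simp add: path_vertex_def)
next
  case (Suc k)
  have "path_vertex \<pi> (Suc k) = path_vertex \<pi> k + step_vec (\<pi> ! k)"
    using Suc.prems by (simp add: path_vertex_def take_Suc_conv_app_nth)
  moreover have "Suc k \<in> path_theta \<pi> \<longleftrightarrow> Theta \<in> decoration (\<pi> ! k)"
    "Suc k \<in> path_xi \<pi> \<longleftrightarrow> Xi \<in> decoration (\<pi> ! k)"
    using Suc.prems by (simp_all add: path_theta_def path_xi_def)
  ultimately show ?case
    using Suc.IH Suc.prems by (cases "\<pi> ! k") (simp_all add: alpha_bound_Suc[OF Suc.hyps])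
qed

lemma path_sets_subset:
  assumes "\<pi> \<in> motzkin_paths n"
  shows "path_theta \<pi> \<subseteq> {2..n}" "path_xi \<pi> \<subseteq> {2..n}"
proof -
  have "\<pi> ! 0 = Up" "length \<pi> = n"
    using assms by (auto simp: motzkin_paths_def hd_conv_nth)
  moreover have "2 \<le> i" if "1 \<le> i" "\<pi> ! (i - 1) \<noteq> Up" for i
    using that \<open>\<pi> ! 0 = Up\<close> by (cases "i = 1") auto
  ultimately show "path_theta \<pi> \<subseteq> {2..n}" "path_xi \<pi> \<subseteq> {2..n}"
    by (fastforce simp: path_theta_def path_xi_def)+
qed

text \<open>Membership of \<open>i\<close> in \<open>T\<close> and in \<open>S\<close> selects one
  of the four steps; nonnegativity of \<open>alpha_bound\<close> becomes height at least 1 through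
  \<open>snd_path_vertex\<close>.\<close>

lemma motzkin_path_exists:
  assumes "n \<ge> 1" "T \<subseteq> {2..n}" "S \<subseteq> {2..n}" "\<forall>i\<in>{1..n}. 0 \<le> alpha_bound T S i"
  shows "\<exists>\<pi>\<in>motzkin_paths n. T = path_theta \<pi> \<and> S = path_xi \<pi>"
proof -
  define step where "step i =
    (if i \<in> T then if i \<in> S then Down else Hor_Theta else if i \<in> S then Hor_Xi else Up)" for i
  define \<pi> where "\<pi> = map step [1..<n + 1]"
  have len: "length \<pi> = n" by (simp add: \<pi>_def)
  have nth: "\<pi> ! (i - 1) = step i" if "i \<in> {1..n}" for i
  proof -
    have "i - 1 < length [1..<n + 1]" "[1..<n + 1] ! (i - 1) = i"
      using that by (auto simp: nth_upt simp del: upt_Suc)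
    then show ?thesis unfolding \<pi>_def by (simp only: nth_map)
  qed
  have T: "path_theta \<pi> = T" and S: "path_xi \<pi> = S"
    using assms(2,3) nth len unfolding path_theta_def path_xi_def
    by (auto simp: step_def split: if_splits)
  have "1 \<notin> T" "1 \<notin> S" using assms(2,3) by auto
  then have "step 1 = Up" by (simp add: step_def)
  moreover have "hd \<pi> = \<pi> ! (1 - 1)" using len assms(1) by (cases \<pi>) auto
  ultimately have hd: "hd \<pi> = Up" using nth[of 1] assms(1) by simp
  have "\<pi> \<in> motzkin_paths n"
    unfolding motzkin_paths_def
  proof (intro CollectI conjI ballI)
    show "\<pi> \<noteq> []" using len assms(1) by auto
    show "1 \<le> snd (path_vertex \<pi> k)" if "k \<in> {1..n}" for k
      using that snd_path_vertex[OF hd, of k] len assms(4) by (simp add: T S)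
  qed (fact len hd)+
  then show ?thesis using T S by blast
qed

text \<open>Since \<open>\<alpha>\<^sub>i\<close> is a natural number, the bounds on \<open>\<alpha>\<close> force the path to stay above its floor.\<close>

lemma B12_iff:
  assumes "n \<ge> 1"
  shows "Monomial \<alpha> T S \<in> B12 n \<longleftrightarrow>
    T \<subseteq> {2..n} \<and> S \<subseteq> {2..n} \<and> (\<forall>i. i \<notin> {2..n} \<longrightarrow> \<alpha> i = 0) \<and> psi n (Monomial \<alpha> T S) \<noteq> None"
proof -
  have 12: "{1..n} = insert 1 {2..n}" using assms by auto
  \<comment> \<open>\<open>alpha_bound T S 1\<close> is 0, so the bound at index 1 reads
    \<open>\<alpha> 1 = 0\<close>; it later joins the support condition.\<close>
  have "(\<forall>i\<in>{1..n}. int (\<alpha> i) \<le> alpha_bound T S i) \<longleftrightarrow>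
      \<alpha> 1 = 0 \<and> (\<forall>i\<in>{2..n}. int (\<alpha> i) \<le> alpha_bound T S i)"
    unfolding 12 by simp
  also have "(\<forall>i\<in>{2..n}. int (\<alpha> i) \<le> alpha_bound T S i) \<longleftrightarrow> psi n (Monomial \<alpha> T S) \<noteq> None"
    using psi_defined_iff[OF assms, of "Monomial \<alpha> T S"] by simp
  finally have bounds: "(\<forall>i\<in>{1..n}. int (\<alpha> i) \<le> alpha_bound T S i) \<longleftrightarrow>
      \<alpha> 1 = 0 \<and> psi n (Monomial \<alpha> T S) \<noteq> None" .
  have supp: "\<alpha> 1 = 0 \<and> (\<forall>i. i \<notin> {1..n} \<longrightarrow> \<alpha> i = 0) \<longleftrightarrow> (\<forall>i. i \<notin> {2..n} \<longrightarrow> \<alpha> i = 0)"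
  proof -
    have "1 \<notin> {2..n}" by simp
    then show ?thesis unfolding 12 by (metis insert_iff)
  qed
  have "Monomial \<alpha> T S \<in> B12 n \<longleftrightarrow> (\<exists>\<pi>\<in>motzkin_paths n. T = path_theta \<pi> \<and> S = path_xi \<pi>) \<and>
      (\<forall>i\<in>{1..n}. int (\<alpha> i) \<le> alpha_bound T S i) \<and> (\<forall>i. i \<notin> {1..n} \<longrightarrow> \<alpha> i = 0)"
    by (simp add: B12_def)
  also have "\<dots> \<longleftrightarrow> T \<subseteq> {2..n} \<and> S \<subseteq> {2..n} \<and>
      (\<forall>i\<in>{1..n}. int (\<alpha> i) \<le> alpha_bound T S i) \<and> (\<forall>i. i \<notin> {1..n} \<longrightarrow> \<alpha> i = 0)"
    (is "?path \<and> ?bd \<and> ?supp \<longleftrightarrow> _")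
  proof -
    have "?bd \<longrightarrow> (?path \<longleftrightarrow> T \<subseteq> {2..n} \<and> S \<subseteq> {2..n})"
    proof
      assume ?bd
      then have "\<forall>i\<in>{1..n}. 0 \<le> alpha_bound T S i"
        by (meson of_nat_0_le_iff order_trans)
      then have "T \<subseteq> {2..n} \<and> S \<subseteq> {2..n} \<Longrightarrow> ?path"
        using motzkin_path_exists[OF assms, of T S] by simp
      moreover have "?path \<Longrightarrow> T \<subseteq> {2..n} \<and> S \<subseteq> {2..n}"
        by (elim bexE conjE) (simp only: path_sets_subset simp_thms)
      ultimately show "?path \<longleftrightarrow> T \<subseteq> {2..n} \<and> S \<subseteq> {2..n}" by (rule iffI[rotated])
    qed
    then show ?thesis by argo
  qed
  finally show ?thesis unfolding bounds supp[symmetric] by argo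
qed

theorem theorem6p2:
  fixes n :: nat
  assumes "n \<ge> 1"
  shows "(\<forall>b\<in>B12 n. psi n b \<noteq> None) \<and>
    bij_betw (\<lambda>b. the (psi n b)) (B12 n) (SW n) \<and>
    (\<forall>b\<in>B12 n. \<forall>\<sigma>. psi n b = Some \<sigma> \<longrightarrow>
       deg_x n b = sminv \<sigma> \<and>
       deg_theta n b = card (ascents \<sigma>) \<and>
       deg_xi n b = card (descents \<sigma>))"
proof (intro conjI)
  have B12: "psi n b \<noteq> None" "theta_set b \<subseteq> {2..n}" "xi_set b \<subseteq> {2..n}"
    "\<And>i. i \<notin> {2..n} \<Longrightarrow> x_exp b i = 0" if "b \<in> B12 n" for b
    using that B12_iff[OF assms, of "x_exp b" "theta_set b" "xi_set b"] by simp_all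
  then show "\<forall>b\<in>B12 n. psi n b \<noteq> None" by blast
  show "bij_betw (\<lambda>b. the (psi n b)) (B12 n) (SW n)"
  proof (rule bij_betw_imageI)
    show "inj_on (\<lambda>b. the (psi n b)) (B12 n)"
    proof (rule inj_onI)
      fix b b' assume b: "b \<in> B12 n" "b' \<in> B12 n" "the (psi n b) = the (psi n b')"
      then obtain \<sigma> where "psi n b = Some \<sigma>" "psi n b' = Some \<sigma>"
        using B12(1) by (metis option.collapse)
      note eq = psi_inj[OF assms this]
      have "x_exp b i = x_exp b' i" for i
        using eq[of i] B12(4)[of _ i] b by (cases "i \<in> {2..n}") auto
      moreover have "theta_set b = theta_set b'" "xi_set b = xi_set b'"
        using eq B12(2,3) b by blast+
      ultimately show "b = b'" by (intro monomial.expand) auto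
    qed
    show "(\<lambda>b. the (psi n b)) ` B12 n = SW n"
    proof (intro equalityI subsetI)
      fix \<sigma> assume "\<sigma> \<in> SW n"
      \<comment> \<open>The conclusion of \<open>psi_surj\<close> supplies all conditions of
        \<open>B12_iff\<close>.\<close>
      from psi_surj[OF assms this] obtain \<alpha> T S where "psi n (Monomial \<alpha> T S) = Some \<sigma>"
        "Monomial \<alpha> T S \<in> B12 n"
        using B12_iff[OF assms] by (metis option.distinct(1))
      then show "\<sigma> \<in> (\<lambda>b. the (psi n b)) ` B12 n" by force
    qed (use B12(1) psi_SW[OF assms] in force)
  qed
  show "\<forall>b\<in>B12 n. \<forall>\<sigma>. psi n b = Some \<sigma> \<longrightarrow>
       deg_x n b = sminv \<sigma> \<and> deg_theta n b = card (ascents \<sigma>) \<and> deg_xi n b = card (descents \<sigma>)"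
  proof (intro ballI allI impI)
    fix b \<sigma> assume b: "b \<in> B12 n" "psi n b = Some \<sigma>"
    \<comment> \<open>The degrees sum from index 1, \<open>psi_statistics\<close> from index 2; the
      extra term is zero.\<close>
    have 12: "{1..n} = insert 1 {2..n}" using assms by auto
    have "x_exp b 1 = 0" "1 \<notin> theta_set b" "1 \<notin> xi_set b" using B12[OF b(1)] by auto
    then show "deg_x n b = sminv \<sigma> \<and> deg_theta n b = card (ascents \<sigma>) \<and>
        deg_xi n b = card (descents \<sigma>)"
      using psi_statistics[OF assms b(2)] unfolding deg_x_def deg_theta_def deg_xi_def 12 by simp
  qed
qed

end
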